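(* For a finite set of classifiers $\mathcal{H}=\{h_1,\dots,h_H\}$, the PAC-Bayesian bound based on the squared distance function with $\chi^2$-divergence measure is given by $$B_{\mathrm{sq},\chi^2}(Q):=\sum_{i=1}^H\hat l_iq_i+\sqrt[4]{\left(\sum_{i=1}^H\frac{q_i^2}{p_i}\right)\left(\frac{12m-11}{16m^3\delta}\right)};$$ that is, for any prior $P=(p_1,\dots,p_H)$ on $\mathcal{H}$ and any $\delta\in(0,1)$, with probability at least $1-\delta$ over i.i.d. samples $S_m$ of size $m$ drawn from $\mathcal{D}$, the averaged true risk satisfies $\mathbb{E}_Q[l]\le B_{\mathrm{sq},\chi^2}(Q)$ for every posterior $Q=(q_1,\dots,q_H)$ on $\mathcal{H}$ (which may depend on $S_m$ and $P$).
   Context: $\mathcal{D}$ is a probability distribution on $\mathcal{X}\times\mathcal{Y}$; $S_m=\{(x_j,y_j)\}_{j=1}^m$ is an i.i.d. sample from $\mathcal{D}$. $\ell(h,x,y)\in[0,1]$ is a loss function. The empirical risk of $h_i$ is $\hat l_i=\frac1m\sum_{j=1}^m\ell(h_i,x_j,y_j)$ and its true risk is $l_i=\mathbb{E}_{(x,y)\sim\mathcal{D}}[\ell(h_i,x,y)]$; $\mathbb{E}_Q[l]=\sum_{i=1}^Hl_iq_i$. The prior $P$ is fixed independently of the sample, with $p_i>0$, $\sum_ip_i=1$; a posterior satisfies $q_i\ge0$, $\sum_iq_i=1$. The squared distance function is $\phi_{\mathrm{sq}}(\hat l,l)=(\hat l-l)^2$.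
   Formalization: The sample size m is assumed to be at least 2: for m = 1 the bound fails (one classifier, loss 1 with probability 4/5 and 0 otherwise, δ = 4/25, where the added term is about 0.7906 < 4/5), and for m = 0 it is undefined. *)

theory Defs
  imports "HOL-Probability.Probability"
begin

definition empirical_risk ::
    "('h \<Rightarrow> 'x \<Rightarrow> 'y \<Rightarrow> real) \<Rightarrow> nat \<Rightarrow> (nat \<Rightarrow> 'x \<times> 'y) \<Rightarrow> 'h \<Rightarrow> real" where
  "empirical_risk loss m S h = (1 / real m) * (\<Sum>j=1..m. loss h (fst (S j)) (snd (S j)))"

definition true_risk ::
    "('h \<Rightarrow> 'x \<Rightarrow> 'y \<Rightarrow> real) \<Rightarrow> ('x \<times> 'y) measure \<Rightarrow> 'h \<Rightarrow> real" where
  "true_risk loss D h = (LINT z|D. loss h (fst z) (snd z))"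

text \<open>
  Distributions on a family of classifiers indexed by \<open>1, \<dots>, n\<close> are weight functions on
  the index set; values outside \<open>{1..n}\<close> are irrelevant. Priors have full support.
\<close>

definition prior :: "nat \<Rightarrow> (nat \<Rightarrow> real) \<Rightarrow> bool" where
  "prior n p \<longleftrightarrow> (\<forall>i\<in>{1..n}. p i > 0) \<and> (\<Sum>i=1..n. p i) = 1"

definition posterior :: "nat \<Rightarrow> (nat \<Rightarrow> real) \<Rightarrow> bool" where
  "posterior n q \<longleftrightarrow> (\<forall>i\<in>{1..n}. q i \<ge> 0) \<and> (\<Sum>i=1..n. q i) = 1"

definition averaged_risk :: "nat \<Rightarrow> (nat \<Rightarrow> real) \<Rightarrow> (nat \<Rightarrow> real) \<Rightarrow> real" where
  "averaged_risk n l q = (\<Sum>i=1..n. l i * q i)"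

text \<open>
  The argument \<open>lhat\<close> is the vector of empirical risks. For \<open>m = 1\<close> the confidence term
  is too small for the PAC-Bayesian inequality to hold: take a single classifier whose loss is
  1 with probability \<open>4/5\<close> and 0 otherwise, and \<open>\<delta> = 4/25\<close>. With probability
  \<open>1/5 > \<delta>\<close> the bound is \<open>root 4 (25/64) < 4/5\<close>, which is below the true risk.
\<close>

definition B_sq_chi2 ::
    "nat \<Rightarrow> nat \<Rightarrow> real \<Rightarrow> (nat \<Rightarrow> real) \<Rightarrow> (nat \<Rightarrow> real) \<Rightarrow> (nat \<Rightarrow> real) \<Rightarrow> real" where
  "B_sq_chi2 n m \<delta> p lhat q =
     (\<Sum>i=1..n. lhat i * q i) +
     root 4 ((\<Sum>i=1..n. (q i)\<^sup>2 / p i) * ((12 * real m - 11) / (16 * real m ^ 3 * \<delta>)))"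

end

theory Submission
  imports Defs
begin

text \<open>
  Write \<open>d\<^sub>i = l\<^sub>i - lhat\<^sub>i\<close> for the deviation of the \<open>i\<close>-th classifier. The posterior is removed
  from the problem by a deterministic inequality: applying Cauchy--Schwarz to
  \<open>\<Sum> \<surd>q\<^sub>i \<cdot> \<surd>q\<^sub>i d\<^sub>i\<close> and then to \<open>\<Sum> (q\<^sub>i/\<surd>p\<^sub>i) \<cdot> (\<surd>p\<^sub>i d\<^sub>i\<^sup>2)\<close> gives
  \<open>(\<Sum> q\<^sub>i d\<^sub>i)^4 \<le> (\<Sum> q\<^sub>i\<^sup>2/p\<^sub>i) (\<Sum> p\<^sub>i d\<^sub>i^4)\<close> (lemma \<open>posterior_mean_le_chi2\<close>).
  The random factor \<open>\<Sum> p\<^sub>i d\<^sub>i^4\<close> does not involve \<open>q\<close>, so a single application of Markov's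
  inequality to it serves all posteriors at once.

  What remains is a bound for the expectation of \<open>d\<^sub>i^4\<close>, the fourth central moment of a mean of
  \<open>m\<close> independent \<open>[0,1]\<close>-valued variables. In the fourth power of a sum of centred independent
  variables only the terms \<open>X\<^sub>j^4\<close> and \<open>X\<^sub>j\<^sup>2 X\<^sub>k\<^sup>2\<close> survive taking expectations; with variance at
  most \<open>1/4\<close> and \<open>X\<^sub>j^4 \<le> X\<^sub>j\<^sup>2\<close> this yields \<open>(3m + 1) / (16 m\<^sup>3)\<close>
  (lemma \<open>fourth_central_moment_sample_mean\<close>), and \<open>3m + 1 \<le> 12m - 11\<close> as soon as \<open>m \<ge> 2\<close>.

  The event in question quantifies over uncountably many posteriors. It is measurable nevertheless,
  because the vectors of empirical risks that satisfy the bound for all \<open>q\<close> form an intersection of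
  closed half-spaces.
\<close>

section \<open>Eliminating the posterior\<close>

lemma posterior_mean_le_chi2:
  assumes "prior n p" "posterior n q"
  shows "(\<Sum>i=1..n. d i * q i) \<le> root 4 ((\<Sum>i=1..n. (q i)\<^sup>2 / p i) * (\<Sum>i=1..n. p i * d i ^ 4))"
proof -
  have p: "p i > 0" if "i \<in> {1..n}" for i
    using assms(1) that by (auto simp: prior_def)
  have q: "q i \<ge> 0" if "i \<in> {1..n}" for i
    using assms(2) that by (auto simp: posterior_def)
  have q1: "(\<Sum>i=1..n. q i) = 1"
    using assms(2) by (auto simp: posterior_def)
  have "(\<Sum>i=1..n. d i * q i)\<^sup>2 = (\<Sum>i=1..n. sqrt (q i) * (sqrt (q i) * d i))\<^sup>2"
    using q by (intro arg_cong[where f="\<lambda>x. x\<^sup>2"] sum.cong) (auto simp flip: mult.assoc)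
  also have "\<dots> \<le> (\<Sum>i=1..n. (sqrt (q i))\<^sup>2) * (\<Sum>i=1..n. (sqrt (q i) * d i)\<^sup>2)"
    by (rule Cauchy_Schwarz_ineq_sum)
  also have "(\<Sum>i=1..n. (sqrt (q i))\<^sup>2) = 1"
    unfolding q1[symmetric] using q by (intro sum.cong) auto
  also have "(\<Sum>i=1..n. (sqrt (q i) * d i)\<^sup>2) = (\<Sum>i=1..n. q i / sqrt (p i) * (sqrt (p i) * (d i)\<^sup>2))"
    using q p by (intro sum.cong) (auto simp: power_mult_distrib less_imp_neq[symmetric])
  finally have "((\<Sum>i=1..n. d i * q i)\<^sup>2)\<^sup>2
      \<le> (\<Sum>i=1..n. q i / sqrt (p i) * (sqrt (p i) * (d i)\<^sup>2))\<^sup>2"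
    by (intro power_mono) auto
  also have "\<dots> \<le> (\<Sum>i=1..n. (q i / sqrt (p i))\<^sup>2) * (\<Sum>i=1..n. (sqrt (p i) * (d i)\<^sup>2)\<^sup>2)"
    by (rule Cauchy_Schwarz_ineq_sum)
  also have "(\<Sum>i=1..n. (q i / sqrt (p i))\<^sup>2) = (\<Sum>i=1..n. (q i)\<^sup>2 / p i)"
    using p by (intro sum.cong) (auto simp: power_divide less_imp_le)
  also have "(\<Sum>i=1..n. (sqrt (p i) * (d i)\<^sup>2)\<^sup>2) = (\<Sum>i=1..n. p i * d i ^ 4)"
    using p by (intro sum.cong) (auto simp: power_mult_distrib less_imp_le)
  finally have "(\<Sum>i=1..n. d i * q i) ^ 4 \<le> (\<Sum>i=1..n. (q i)\<^sup>2 / p i) * (\<Sum>i=1..n. p i * d i ^ 4)"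
    by simp
  then have "root 4 ((\<Sum>i=1..n. d i * q i) ^ 4)
      \<le> root 4 ((\<Sum>i=1..n. (q i)\<^sup>2 / p i) * (\<Sum>i=1..n. p i * d i ^ 4))"
    by simp
  moreover have "root 4 ((\<Sum>i=1..n. d i * q i) ^ 4) = \<bar>\<Sum>i=1..n. d i * q i\<bar>"
    using real_root_power_cancel[of 4 "\<bar>\<Sum>i=1..n. d i * q i\<bar>"] by simp
  ultimately show ?thesis
    by linarith
qed

section \<open>Fourth moments\<close>

text \<open>
  Induction on \<open>J\<close>. In the expansion of \<open>(X + S)^4\<close> for independent \<open>X\<close>, \<open>S\<close> the terms with an odd
  exponent contain a factor \<open>E X = 0\<close> or \<open>E S = 0\<close>, so that
  \<open>E (X + S)^4 = E X^4 + 6 (E X\<^sup>2) (E S\<^sup>2) + E S^4\<close>. This needs the first two moments of \<open>S\<close>,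
  hence the simultaneous statement.
\<close>

lemma (in prob_space) moments_sum_indep:
  fixes X :: "'i \<Rightarrow> 'a \<Rightarrow> real" and v :: real
  assumes "finite J" and "indep_vars (\<lambda>_. borel) X J"
    and "\<And>j \<omega>. j \<in> J \<Longrightarrow> \<omega> \<in> space M \<Longrightarrow> \<bar>X j \<omega>\<bar> \<le> 1"
    and "\<And>j. j \<in> J \<Longrightarrow> expectation (X j) = 0"
    and "\<And>j. j \<in> J \<Longrightarrow> expectation (\<lambda>\<omega>. X j \<omega> ^ 2) \<le> v"
  shows "expectation (\<lambda>\<omega>. \<Sum>j\<in>J. X j \<omega>) = 0 \<and>
    expectation (\<lambda>\<omega>. (\<Sum>j\<in>J. X j \<omega>) ^ 2) \<le> card J * v \<and>
    expectation (\<lambda>\<omega>. (\<Sum>j\<in>J. X j \<omega>) ^ 4)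
      \<le> card J * v + 3 * real (card J) * (real (card J) - 1) * v ^ 2"
  using assms
proof (induction J)
  case empty
  then show ?case by simp
next
  case (insert i J)
  define Y where "Y = X i"
  define S where "S = (\<lambda>\<omega>. \<Sum>j\<in>J. X j \<omega>)"
  define k where "k = real (card J)"
  have rv: "random_variable borel (X j)" if "j \<in> insert i J" for j
    using insert.prems(1) that by (auto simp: indep_vars_def)
  have IH: "expectation S = 0" "expectation (\<lambda>\<omega>. S \<omega> ^ 2) \<le> k * v"
    "expectation (\<lambda>\<omega>. S \<omega> ^ 4) \<le> k * v + 3 * k * (k - 1) * v ^ 2"
    using insert.IH[OF indep_vars_subset[OF insert.prems(1)]] insert.prems(2,3,4)
    by (auto simp: S_def k_def)
  have ind: "indep_var borel Y borel S"
    unfolding Y_def S_def using insert by (intro indep_vars_sum) auto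
  have Y[measurable]: "random_variable borel Y" and S[measurable]: "random_variable borel S"
    using rv by (auto simp: Y_def S_def)
  have Y1: "\<bar>Y \<omega>\<bar> \<le> 1" if "\<omega> \<in> space M" for \<omega>
    using insert.prems(2) that by (simp add: Y_def)
  have Sk: "\<bar>S \<omega>\<bar> \<le> k" if "\<omega> \<in> space M" for \<omega>
  proof -
    have "\<bar>S \<omega>\<bar> \<le> (\<Sum>j\<in>J. \<bar>X j \<omega>\<bar>)"
      unfolding S_def by (rule sum_abs)
    also have "\<dots> \<le> (\<Sum>j\<in>J. 1)"
      using insert.prems(2) that by (intro sum_mono) auto
    finally show ?thesis by (simp add: k_def)
  qed
  have intY: "integrable M (\<lambda>\<omega>. Y \<omega> ^ a)" for a
    using Y1 by (intro integrable_const_bound[of _ 1] AE_I2) (auto simp: power_abs power_le_one)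
  have intS: "integrable M (\<lambda>\<omega>. S \<omega> ^ b)" for b
    using Sk by (intro integrable_const_bound[of _ "k ^ b"] AE_I2) (auto simp: power_abs intro!: power_mono)
  have "indep_var borel ((\<lambda>y. y ^ a) \<circ> Y) borel ((\<lambda>s. s ^ b) \<circ> S)" for a b
    by (rule indep_var_compose[OF ind]) auto
  then have indp: "indep_var borel (\<lambda>\<omega>. Y \<omega> ^ a) borel (\<lambda>\<omega>. S \<omega> ^ b)" for a b
    by (simp add: comp_def)
  note int[simp] = indep_var_integrable[OF indp intY intS]
  note ex = indep_var_lebesgue_integral[OF indp intY intS]
  have int1[simp]: "integrable M Y" "integrable M S"
    using intY[of 1] intS[of 1] by simp_all
  have EY: "expectation Y = 0" "expectation (\<lambda>\<omega>. Y \<omega> ^ 2) \<le> v"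
    using insert.prems(3,4) by (auto simp: Y_def)
  have "0 \<le> expectation (\<lambda>\<omega>. Y \<omega> ^ 2)"
    by simp
  also note EY(2)
  finally have v: "0 \<le> v" .
  have sum_eq: "(\<Sum>j\<in>insert i J. X j \<omega>) = Y \<omega> + S \<omega>" for \<omega>
    using insert by (simp add: Y_def S_def)
  have card_eq: "real (card (insert i J)) = k + 1"
    using insert by (simp add: k_def)
  have "expectation (\<lambda>\<omega>. Y \<omega> + S \<omega>) = 0"
    using EY IH by simp
  moreover have "expectation (\<lambda>\<omega>. (Y \<omega> + S \<omega>) ^ 2) \<le> (k + 1) * v"
  proof -
    have "expectation (\<lambda>\<omega>. (Y \<omega> + S \<omega>) ^ 2)
        = expectation (\<lambda>\<omega>. Y \<omega> ^ 2 + 2 * (Y \<omega> ^ 1 * S \<omega> ^ 1) + S \<omega> ^ 2)"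
      by (simp add: power2_sum algebra_simps)
    also have "\<dots> = expectation (\<lambda>\<omega>. Y \<omega> ^ 2) + expectation (\<lambda>\<omega>. S \<omega> ^ 2)"
      using ex[of 1 1] int[of 1 1] EY IH intY intS by simp
    finally show ?thesis
      using EY IH by (simp add: algebra_simps)
  qed
  moreover have "expectation (\<lambda>\<omega>. (Y \<omega> + S \<omega>) ^ 4) \<le> (k + 1) * v + 3 * (k + 1) * (k + 1 - 1) * v ^ 2"
  proof -
    have "expectation (\<lambda>\<omega>. (Y \<omega> + S \<omega>) ^ 4) = expectation (\<lambda>\<omega>. Y \<omega> ^ 4 + 4 * (Y \<omega> ^ 3 * S \<omega> ^ 1)
        + 6 * (Y \<omega> ^ 2 * S \<omega> ^ 2) + 4 * (Y \<omega> ^ 1 * S \<omega> ^ 3) + S \<omega> ^ 4)"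
      by (simp add: power4_eq_xxxx power3_eq_cube power2_eq_square algebra_simps)
    also have "\<dots> = expectation (\<lambda>\<omega>. Y \<omega> ^ 4)
        + 6 * (expectation (\<lambda>\<omega>. Y \<omega> ^ 2) * expectation (\<lambda>\<omega>. S \<omega> ^ 2)) + expectation (\<lambda>\<omega>. S \<omega> ^ 4)"
      using ex[of 3 1] ex[of 2 2] ex[of 1 3] int[of 3 1] int[of 2 2] int[of 1 3] EY IH intY intS
      by simp
    also have "expectation (\<lambda>\<omega>. Y \<omega> ^ 4) \<le> expectation (\<lambda>\<omega>. Y \<omega> ^ 2)"
    proof (rule integral_mono[OF intY intY])
      fix \<omega> assume "\<omega> \<in> space M"
      then have "\<bar>Y \<omega>\<bar> ^ 4 \<le> \<bar>Y \<omega>\<bar> ^ 2"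
        using Y1 by (intro power_decreasing) auto
      then show "Y \<omega> ^ 4 \<le> Y \<omega> ^ 2"
        by simp
    qed
    also have "expectation (\<lambda>\<omega>. Y \<omega> ^ 2) * expectation (\<lambda>\<omega>. S \<omega> ^ 2) \<le> v * (k * v)"
      using EY IH v by (intro mult_mono) (auto intro!: integral_nonneg_AE)
    finally show ?thesis
      using EY IH by (simp add: algebra_simps power2_eq_square)
  qed
  ultimately show ?case
    unfolding sum_eq card_eq by blast
qed

text \<open>
  Independence says that the joint law is the product of the marginal laws; for the coordinates
  of a product space the joint law is that product by construction.
\<close>

lemma indep_vars_PiM_coordinates:
  assumes "\<And>i. i \<in> I \<Longrightarrow> prob_space (M i)" "I \<noteq> {}"
  shows "prob_space.indep_vars (Pi\<^sub>M I M) M (\<lambda>i S. S i) I"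
proof -
  interpret P: prob_space "Pi\<^sub>M I M"
    by (rule prob_space_PiM) (use assms in auto)
  have "distr (Pi\<^sub>M I M) (Pi\<^sub>M I M) (\<lambda>S. \<lambda>i\<in>I. S i) = distr (Pi\<^sub>M I M) (Pi\<^sub>M I M) (\<lambda>S. S)"
    by (intro distr_cong) (auto simp: space_PiM PiE_restrict)
  also have "\<dots> = Pi\<^sub>M I (\<lambda>i. distr (Pi\<^sub>M I M) (M i) (\<lambda>S. S i))"
    using assms by (simp add: distr_PiM_component cong: PiM_cong)
  finally show ?thesis
    using assms by (subst P.indep_vars_iff_distr_eq_PiM') auto
qed

text \<open>
  Variables with values in \<open>[0,1]\<close> satisfy \<open>f\<^sup>2 \<le> f\<close>, so with mean \<open>\<mu>\<close> their variance is at
  most \<open>\<mu> (1 - \<mu>) \<le> 1/4\<close>.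
\<close>

lemma (in prob_space) variance_unit_interval_le:
  fixes f :: "'a \<Rightarrow> real"
  assumes [measurable]: "random_variable borel f" and f01: "\<And>\<omega>. \<omega> \<in> space M \<Longrightarrow> f \<omega> \<in> {0..1}"
  shows "variance f \<le> 1 / 4"
proof -
  have int: "integrable M f" "integrable M (\<lambda>\<omega>. (f \<omega>)\<^sup>2)"
    using f01 by (auto intro!: integrable_const_bound[of _ 1] AE_I2 simp: power_le_one)
  have "expectation (\<lambda>\<omega>. (f \<omega>)\<^sup>2) \<le> expectation f"
    using f01 by (intro integral_mono int) (auto simp: power2_eq_square mult_left_le)
  then have "variance f \<le> expectation f - (expectation f)\<^sup>2"
    using int by (simp add: variance_eq)
  also have "\<dots> = 1 / 4 - (expectation f - 1 / 2)\<^sup>2"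
    by (simp add: power2_eq_square algebra_simps)
  finally show ?thesis
    by (smt (verit) zero_le_power2)
qed

lemma (in prob_space) fourth_central_moment_sample_mean:
  fixes f :: "'a \<Rightarrow> real" and m :: nat
  assumes [measurable]: "random_variable borel f" and f01: "\<And>z. z \<in> space M \<Longrightarrow> f z \<in> {0..1}"
    and m: "m \<ge> 1"
  shows "(LINT S|Pi\<^sub>M {1..m} (\<lambda>_. M). (expectation f - (1 / real m) * (\<Sum>j=1..m. f (S j))) ^ 4)
    \<le> (3 * real m + 1) / (16 * real m ^ 3)"
proof -
  let ?P = "Pi\<^sub>M {1..m} (\<lambda>_. M)"
  interpret P: prob_space ?P
    by (rule prob_space_PiM) (rule prob_space_axioms)
  define \<mu> where "\<mu> = expectation f"
  have intf: "integrable M f"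
    using f01 by (auto intro!: integrable_const_bound[of _ 1] AE_I2)
  have "0 \<le> \<mu>"
    unfolding \<mu>_def using f01 by (intro integral_nonneg_AE AE_I2) auto
  moreover have "\<mu> \<le> expectation (\<lambda>_. 1)"
    unfolding \<mu>_def using f01 intf by (intro integral_mono) auto
  ultimately have \<mu>: "0 \<le> \<mu>" "\<mu> \<le> 1"
    by (auto simp: prob_space)
  have transfer: "(LINT S|?P. g (S j)) = expectation g"
    if "j \<in> {1..m}" "random_variable borel g" for j and g :: "'a \<Rightarrow> real"
  proof -
    have "expectation g = integral\<^sup>L (distr ?P M (\<lambda>S. S j)) g"
      using that prob_space_axioms by (subst distr_PiM_component) auto
    also have "\<dots> = (LINT S|?P. g (S j))"
      using that by (intro integral_distr) auto
    finally show ?thesis ..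
  qed
  define X where "X = (\<lambda>(j :: nat) S. f (S j) - \<mu>)"
  have indX: "P.indep_vars (\<lambda>_. borel) X {1..m}"
    unfolding X_def
    using P.indep_vars_compose2[OF indep_vars_PiM_coordinates[of "{1..m}" "\<lambda>_. M"],
        of "\<lambda>_ z. f z - \<mu>" "\<lambda>_. borel"] m prob_space_axioms
    by auto
  have bX: "\<bar>X j S\<bar> \<le> 1" if "j \<in> {1..m}" "S \<in> space ?P" for j S
  proof -
    have "S j \<in> space M"
      using that by (auto simp: space_PiM)
    then show ?thesis
      using f01[of "S j"] \<mu> by (auto simp: X_def)
  qed
  have X0: "P.expectation (X j) = 0" if "j \<in> {1..m}" for j
    using transfer[OF that, of "\<lambda>z. f z - \<mu>"] intf by (simp add: X_def \<mu>_def prob_space)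
  have X2: "P.expectation (\<lambda>S. X j S ^ 2) \<le> 1 / 4" if "j \<in> {1..m}" for j
    using transfer[OF that, of "\<lambda>z. (f z - \<mu>)\<^sup>2"] variance_unit_interval_le[of f] f01
    by (simp add: X_def \<mu>_def)
  have "P.expectation (\<lambda>S. (\<Sum>j=1..m. X j S) ^ 4)
      \<le> real m * (1 / 4) + 3 * real m * (real m - 1) * (1 / 4) ^ 2"
    using P.moments_sum_indep[OF _ indX bX X0 X2] by simp
  then have le: "P.expectation (\<lambda>S. (\<Sum>j=1..m. X j S) ^ 4) \<le> real m * (3 * real m + 1) / 16"
    by (simp add: field_simps power2_eq_square)
  have "(\<mu> - (1 / real m) * (\<Sum>j=1..m. f (S j))) ^ 4 = (\<Sum>j=1..m. X j S) ^ 4 / real m ^ 4" for S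
  proof -
    have "\<mu> - (1 / real m) * (\<Sum>j=1..m. f (S j)) = - (\<Sum>j=1..m. X j S) / real m"
      using m by (simp add: X_def sum_subtractf field_simps)
    then show ?thesis
      by (simp add: power_divide)
  qed
  then have "P.expectation (\<lambda>S. (\<mu> - (1 / real m) * (\<Sum>j=1..m. f (S j))) ^ 4)
      = P.expectation (\<lambda>S. (\<Sum>j=1..m. X j S) ^ 4) / real m ^ 4"
    by simp
  also have "\<dots> \<le> (real m * (3 * real m + 1) / 16) / real m ^ 4"
    using le by (intro divide_right_mono) auto
  also have "\<dots> = (3 * real m + 1) / (16 * real m ^ 3)"
    using m by (simp add: field_simps eval_nat_numeral)
  finally show ?thesis
    unfolding \<mu>_def .
qed

section \<open>The bound\<close>

text \<open>
  For each fixed \<open>q\<close> the inequality is affine in the empirical risks, so the vectors of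
  empirical risks that satisfy all of them form a closed set in the product topology.
\<close>

lemma sets_uniform_averaged_risk_bound:
  assumes [measurable]: "\<And>i. i \<in> {1..n} \<Longrightarrow> (\<lambda>\<omega>. lhat \<omega> i) \<in> borel_measurable M"
  shows "{\<omega> \<in> space M. \<forall>q. posterior n q \<longrightarrow> averaged_risk n l q \<le> B_sq_chi2 n m \<delta> p (lhat \<omega>) q}
    \<in> sets M"
proof -
  \<comment> \<open>Truncating to \<open>{1..n}\<close> makes every coordinate measurable and leaves the bound unchanged.\<close>
  define L where "L = (\<lambda>\<omega> i. if i \<in> {1..n} then lhat \<omega> i else 0)"
  define C where "C = {x. \<forall>q. posterior n q \<longrightarrow> averaged_risk n l q \<le> B_sq_chi2 n m \<delta> p x q}"
  have "(\<lambda>\<omega>. L \<omega> i) \<in> borel_measurable M" for i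
    unfolding L_def using assms by (cases "i \<in> {1..n}") (simp_all only: if_True if_False borel_measurable_const)
  then have L: "L \<in> borel_measurable M"
    by (rule measurable_coordinatewise_then_product)
  have "C = (\<Inter>q\<in>{q. posterior n q}. {x. averaged_risk n l q \<le> B_sq_chi2 n m \<delta> p x q})"
    by (auto simp: C_def)
  moreover have "closed {x. averaged_risk n l q \<le> B_sq_chi2 n m \<delta> p x q}" for q
    unfolding B_sq_chi2_def
    by (intro closed_Collect_le continuous_intros continuous_on_product_coordinates)
  ultimately have "closed C"
    by auto
  then have "L -` C \<inter> space M \<in> sets M"
    using L by (auto intro: measurable_sets)
  moreover have "B_sq_chi2 n m \<delta> p (L \<omega>) q = B_sq_chi2 n m \<delta> p (lhat \<omega>) q" for \<omega> q
    by (simp add: B_sq_chi2_def L_def)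
  then have "L -` C \<inter> space M = {\<omega> \<in> space M. \<forall>q. posterior n q \<longrightarrow>
      averaged_risk n l q \<le> B_sq_chi2 n m \<delta> p (lhat \<omega>) q}"
    by (auto simp: C_def)
  ultimately show ?thesis
    by simp
qed

theorem theorem6:
  fixes D :: "('x \<times> 'y) measure"
    and loss :: "'h \<Rightarrow> 'x \<Rightarrow> 'y \<Rightarrow> real"
    and h :: "nat \<Rightarrow> 'h"
    and n m :: nat
    and p :: "nat \<Rightarrow> real"
    and \<delta> :: real
  assumes "prob_space D"
    and "\<And>i. i \<in> {1..n} \<Longrightarrow> (\<lambda>z. loss (h i) (fst z) (snd z)) \<in> borel_measurable D"
    and "\<And>i x y. i \<in> {1..n} \<Longrightarrow> (x, y) \<in> space D \<Longrightarrow> loss (h i) x y \<in> {0..1}"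
    and "m \<ge> 2"
    and "prior n p"
    and "0 < \<delta>" and "\<delta> < 1"
  shows "measure (Pi\<^sub>M {1..m} (\<lambda>_. D))
           {S \<in> space (Pi\<^sub>M {1..m} (\<lambda>_. D)).
              \<forall>q. posterior n q \<longrightarrow>
                averaged_risk n (\<lambda>i. true_risk loss D (h i)) q
                  \<le> B_sq_chi2 n m \<delta> p (\<lambda>i. empirical_risk loss m S (h i)) q}
         \<ge> 1 - \<delta>"
proof -
  let ?P = "Pi\<^sub>M {1..m} (\<lambda>_. D)"
  interpret D: prob_space D by fact
  interpret P: prob_space ?P
    by (rule prob_space_PiM) (rule assms(1))
  define f where "f = (\<lambda>i z. loss (h i) (fst z) (snd z))"
  define lhat where "lhat = (\<lambda>S i. empirical_risk loss m S (h i))"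
  define l where "l = (\<lambda>i. true_risk loss D (h i))"
  define d where "d = (\<lambda>i S. l i - lhat S i)"
  define W where "W = (\<lambda>S. \<Sum>i=1..n. p i * d i S ^ 4)"
  define K where "K = (12 * real m - 11) / (16 * real m ^ 3)"
  define good where "good = {S \<in> space ?P. \<forall>q. posterior n q \<longrightarrow>
    averaged_risk n l q \<le> B_sq_chi2 n m \<delta> p (lhat S) q}"
  have p: "p i > 0" if "i \<in> {1..n}" for i
    using assms(5) that by (auto simp: prior_def)
  have p1: "(\<Sum>i=1..n. p i) = 1"
    using assms(5) by (auto simp: prior_def)
  have K: "K > 0"
    using assms(4) by (simp add: K_def)
  have f[measurable]: "f i \<in> borel_measurable D" if "i \<in> {1..n}" for i
    using assms(2) that by (simp add: f_def)
  have f01: "f i z \<in> {0..1}" if "i \<in> {1..n}" "z \<in> space D" for i z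
    using assms(3)[of i "fst z" "snd z"] that by (simp add: f_def)
  have lhat_eq: "lhat S i = (1 / real m) * (\<Sum>j=1..m. f i (S j))" for S i
    by (simp add: lhat_def empirical_risk_def f_def)
  have l_eq: "l i = D.expectation (f i)" for i
    by (simp add: l_def true_risk_def f_def)
  have lhat[measurable]: "(\<lambda>S. lhat S i) \<in> borel_measurable ?P" if "i \<in> {1..n}" for i
    unfolding lhat_eq using f[OF that] by measurable
  have lhat01: "lhat S i \<in> {0..1}" if "i \<in> {1..n}" "S \<in> space ?P" for S i
  proof -
    have "f i (S j) \<in> {0..1}" if "j \<in> {1..m}" for j
      using that by (intro f01 \<open>i \<in> {1..n}\<close> PiE_mem[OF \<open>S \<in> space ?P\<close>[unfolded space_PiM]])
    then have "0 \<le> (\<Sum>j=1..m. f i (S j))" "(\<Sum>j=1..m. f i (S j)) \<le> (\<Sum>j=1..m. 1)"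
      by (auto intro!: sum_nonneg sum_mono simp del: sum_constant)
    then show ?thesis
      using assms(4) by (simp add: lhat_eq divide_simps)
  qed
  have d_int: "integrable ?P (\<lambda>S. d i S ^ 4)" if i: "i \<in> {1..n}" for i
  proof (intro P.integrable_const_bound[of _ "(\<bar>l i\<bar> + 1) ^ 4"] AE_I2)
    fix S assume "S \<in> space ?P"
    then have "\<bar>d i S\<bar> \<le> \<bar>l i\<bar> + 1"
      using lhat01[OF i] by (force simp: d_def)
    then have "\<bar>d i S\<bar> ^ 4 \<le> (\<bar>l i\<bar> + 1) ^ 4"
      by (intro power_mono) auto
    then show "norm (d i S ^ 4) \<le> (\<bar>l i\<bar> + 1) ^ 4"
      by (simp add: power_abs)
  qed (use lhat[OF i] in \<open>unfold d_def, measurable\<close>)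
  have W_int: "integrable ?P W"
    unfolding W_def using d_int by (intro Bochner_Integration.integrable_sum integrable_mult_right) auto
  then have [measurable]: "W \<in> borel_measurable ?P"
    by auto
  have "P.expectation W = (\<Sum>i=1..n. p i * P.expectation (\<lambda>S. d i S ^ 4))"
    unfolding W_def using d_int by (subst Bochner_Integration.integral_sum) auto
  also have "\<dots> \<le> (\<Sum>i=1..n. p i * K)"
  proof (intro sum_mono mult_left_mono)
    fix i assume i: "i \<in> {1..n}"
    have "P.expectation (\<lambda>S. d i S ^ 4) \<le> (3 * real m + 1) / (16 * real m ^ 3)"
      unfolding d_def l_eq lhat_eq
      using assms(4) f01[OF i] f[OF i] by (intro D.fourth_central_moment_sample_mean) auto
    also have "\<dots> \<le> K"
      unfolding K_def using assms(4) by (intro divide_right_mono) auto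
    finally show "P.expectation (\<lambda>S. d i S ^ 4) \<le> K" .
  qed (use p in \<open>auto intro: less_imp_le\<close>)
  also have "\<dots> = K"
    using p1 by (simp flip: sum_distrib_right)
  finally have EW: "P.expectation W \<le> K" .
  have W0: "W S \<ge> 0" for S
    unfolding W_def using p by (intro sum_nonneg mult_nonneg_nonneg) (auto intro: less_imp_le)
  have "P.prob {S \<in> space ?P. W S \<ge> K / \<delta>} \<le> P.expectation W / (K / \<delta>)"
    using W_int W0 K assms(6) by (intro integral_Markov_inequality_measure[where A="{}"]) auto
  also have "\<dots> \<le> K / (K / \<delta>)"
    using EW K assms(6) by (intro divide_right_mono) auto
  also have "\<dots> = \<delta>"
    using K by simp
  finally have bad: "P.prob {S \<in> space ?P. W S \<ge> K / \<delta>} \<le> \<delta>" .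
  have good_sets: "good \<in> sets ?P"
    unfolding good_def by (intro sets_uniform_averaged_risk_bound lhat)
  have "space ?P - {S \<in> space ?P. W S \<ge> K / \<delta>} \<subseteq> good"
  proof
    fix S assume "S \<in> space ?P - {S \<in> space ?P. W S \<ge> K / \<delta>}"
    then have S: "S \<in> space ?P" "W S \<le> K / \<delta>"
      by auto
    have "averaged_risk n l q \<le> B_sq_chi2 n m \<delta> p (lhat S) q" if q: "posterior n q" for q
    proof -
      have "averaged_risk n l q = (\<Sum>i=1..n. lhat S i * q i) + (\<Sum>i=1..n. d i S * q i)"
        by (simp add: averaged_risk_def d_def left_diff_distrib sum_subtractf)
      also have "(\<Sum>i=1..n. d i S * q i) \<le> root 4 ((\<Sum>i=1..n. (q i)\<^sup>2 / p i) * W S)"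
        unfolding W_def using posterior_mean_le_chi2[OF assms(5) q] .
      also have "\<dots> \<le> root 4 ((\<Sum>i=1..n. (q i)\<^sup>2 / p i) * (K / \<delta>))"
        using S p by (intro real_root_le_mono mult_left_mono sum_nonneg)
          (auto intro!: divide_nonneg_nonneg less_imp_le[OF p])
      finally show ?thesis
        by (simp add: B_sq_chi2_def K_def)
    qed
    then show "S \<in> good"
      using S by (auto simp: good_def)
  qed
  then have "P.prob (space ?P - {S \<in> space ?P. W S \<ge> K / \<delta>}) \<le> P.prob good"
    using good_sets by (rule P.finite_measure_mono)
  moreover have "P.prob (space ?P - {S \<in> space ?P. W S \<ge> K / \<delta>})
      = 1 - P.prob {S \<in> space ?P. W S \<ge> K / \<delta>}"
    by (rule P.prob_compl) measurable
  ultimately have "1 - \<delta> \<le> P.prob good"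
    using bad by linarith
  then show ?thesis
    unfolding good_def l_def lhat_def .
qed

end
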